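(* Let $l\in\mathbb{R}$ and let $n$ be an even positive integer. Let $\mathbb{X}$ be a $3$-dimensional real polyhedral Banach space (that is, $\mathbb{R}^3$ with a norm) such that $B_{\mathbb{X}}$ is the prism with vertices $$\Bigl(\cos\tfrac{(j-1)\pi}{n}+ l,\ \sin\tfrac{(j-1)\pi}{n},\ 1\Bigr)\quad\text{and}\quad \Bigl(\cos\tfrac{(j-1)\pi}{n}- l,\ \sin\tfrac{(j-1)\pi}{n},\ -1\Bigr),\qquad j\in\{1,2,\ldots,2n\}.$$ Then $n(\mathbb{X})=\tan\frac{\pi}{2n}$.
   Context: All Banach spaces are real. For a Banach space $\mathbb{X}$, $B_{\mathbb{X}}$ and $S_{\mathbb{X}}$ are its closed unit ball and unit sphere, $\mathbb{X}^*$ is the dual space, and $L(\mathbb{X})$ is the space of bounded linear operators on $\mathbb{X}$ with the operator norm. For $T\in L(\mathbb{X})$ the numerical radius is $v(T)=\sup\{|x^*(Tx)|: x\in S_{\mathbb{X}},\ x^*\in S_{\mathbb{X}^*},\ x^*(x)=1\}$, and the numerical index is $n(\mathbb{X})=\inf\{v(T):T\in L(\mathbb{X}),\ \|T\|=1\}$. A finite-dimensional Banach space is polyhedral if its unit ball has only finitely many extreme points (its vertices); the unit ball is then the convex hull of its vertices. *)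

theory Defs
  imports "HOL-Analysis.Analysis"
begin

text \<open>
  The norm of a Banach space is carried as an explicit function \<open>N\<close> on a real vector space,
  since the class norm of \<^typ>\<open>real^3\<close> is the Euclidean one. \<open>is_norm\<close> does not ask for
  completeness, which is automatic in finite dimension.
\<close>

definition is_norm :: "('a::real_vector \<Rightarrow> real) \<Rightarrow> bool" where
  "is_norm N \<longleftrightarrow>
     (\<forall>x. 0 \<le> N x) \<and>
     (\<forall>x. N x = 0 \<longleftrightarrow> x = 0) \<and>
     (\<forall>c x. N (c *\<^sub>R x) = \<bar>c\<bar> * N x) \<and>
     (\<forall>x y. N (x + y) \<le> N x + N y)"

definition unit_ball :: "('a::real_vector \<Rightarrow> real) \<Rightarrow> 'a set" where
  "unit_ball N = {x. N x \<le> 1}"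

definition unit_sphere :: "('a::real_vector \<Rightarrow> real) \<Rightarrow> 'a set" where
  "unit_sphere N = {x. N x = 1}"

definition bounded_operators ::
  "('a::real_vector \<Rightarrow> real) \<Rightarrow> ('b::real_vector \<Rightarrow> real) \<Rightarrow> ('a \<Rightarrow> 'b) set" where
  "bounded_operators N M = {T. linear T \<and> (\<exists>K. \<forall>x. M (T x) \<le> K * N x)}"

definition operator_norm ::
  "('a::real_vector \<Rightarrow> real) \<Rightarrow> ('b::real_vector \<Rightarrow> real) \<Rightarrow> ('a \<Rightarrow> 'b) \<Rightarrow> real" where
  "operator_norm N M T = (SUP x\<in>unit_ball N. M (T x))"

definition dual_space :: "('a::real_vector \<Rightarrow> real) \<Rightarrow> ('a \<Rightarrow> real) set" where
  "dual_space N = bounded_operators N abs"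

definition dual_norm :: "('a::real_vector \<Rightarrow> real) \<Rightarrow> ('a \<Rightarrow> real) \<Rightarrow> real" where
  "dual_norm N = operator_norm N abs"

definition numerical_radius :: "('a::real_vector \<Rightarrow> real) \<Rightarrow> ('a \<Rightarrow> 'a) \<Rightarrow> real" where
  "numerical_radius N T =
     Sup {\<bar>f (T x)\<bar> | x f. x \<in> unit_sphere N \<and> f \<in> dual_space N \<and> dual_norm N f = 1 \<and> f x = 1}"

definition numerical_index :: "('a::real_vector \<Rightarrow> real) \<Rightarrow> real" where
  "numerical_index N =
     Inf {numerical_radius N T | T. T \<in> bounded_operators N N \<and> operator_norm N N T = 1}"

definition polyhedral :: "('a::real_vector \<Rightarrow> real) \<Rightarrow> bool" where
  "polyhedral N \<longleftrightarrow> finite {v. v extreme_point_of unit_ball N}"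

definition prism_vertices :: "nat \<Rightarrow> real \<Rightarrow> (real^3) set" where
  "prism_vertices n l =
     (\<Union>j\<in>{1..2 * n}.
        {vector [cos ((real j - 1) * pi / real n) + l, sin ((real j - 1) * pi / real n), 1],
         vector [cos ((real j - 1) * pi / real n) - l, sin ((real j - 1) * pi / real n), - 1]})"

end

theory Submission
  imports Defs
begin

text \<open>
  The shear \<open>(x, y, z) \<mapsto> (x - l z, y, z)\<close> carries the ball onto the right prism over the regular
  \<open>2n\<close>-gon \<open>P\<close> inscribed in the unit circle, so the space is the \<open>\<ell>\<^sub>\<infinity>\<close>-sum of the plane normed by
  \<open>P\<close> and the line.  Write \<open>\<alpha> = \<pi>/(2n)\<close>.  The vertices of \<open>P\<close> sit at the even multiples of \<open>\<alpha>\<close>, its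
  edge normals at the odd multiples, and a vertex lies on an edge exactly when the two angles differ
  by \<open>\<alpha>\<close>.

  The infimum is attained at the quarter turn \<open>J\<close> of \<open>P\<close>, extended by zero to the third coordinate
  (\<open>quarter_turn\<close>).  Since \<open>n\<close> is even, \<open>J\<close> is a symmetry of \<open>P\<close>, so the operator has norm 1.  The
  rotations by \<open>\<plusminus>2\<alpha>\<close> are symmetries of \<open>P\<close> too, whence \<open>cos 2\<alpha> I \<plusminus> sin 2\<alpha> J\<close> are contractions; evaluated
  at a point and a functional supporting the ball there they give numerical radius at most
  \<open>(1 - cos 2\<alpha>) / sin 2\<alpha> = tan \<alpha>\<close> (\<open>numerical_radius_quarter_turn\<close>).

  Conversely, let an operator \<open>T\<close> have numerical radius \<open>v\<close>.  Its norm is the largest value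
  \<open>\<bar>f (T x)\<bar>\<close> over facet functionals \<open>f\<close> and vertices \<open>x\<close>, and \<open>v\<close> bounds these values when \<open>x\<close> lies
  on the facet of \<open>f\<close>.  The claim is that \<open>v cot \<alpha>\<close> bounds them all (\<open>numerical_radius_ge\<close>).  Each
  vertex lies, up to sign, on the top facet, so only lateral facets matter, and these reduce to the
  plane: the contribution of the third column of \<open>T\<close> is replaced by a rank-one planar operator
  (\<open>lateral_bound\<close>).  In the plane (\<open>plane_form_bound\<close>), a \<open>2 \<times> 2\<close> matrix tested against a normal at
  angle \<open>\<theta>\<close> and a vertex at angle \<open>\<phi>\<close> gives
  \<open>p cos (\<theta> - \<phi>) + q sin (\<theta> - \<phi>) + r cos (\<theta> + \<phi> - \<psi>)\<close>.
  Choosing the incident pair well isolates \<open>\<bar>p\<bar> cos \<alpha> + \<bar>q\<bar> sin \<alpha> + r cos 2\<alpha> \<le> v cos \<alpha>\<close>, while at every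
  pair the value is at most \<open>(\<bar>p\<bar> + \<bar>q\<bar>) cos \<alpha> + r\<close>, because for even \<open>n\<close> both the cosine and
  the sine of an odd multiple of \<open>\<alpha>\<close> are at most \<open>cos \<alpha>\<close> in modulus.  Multiplied by \<open>tan \<alpha>\<close>
  the second expression is dominated by the first when \<open>n \<ge> 4\<close>; the square \<open>n = 2\<close> is immediate.
\<close>

section \<open>Norms, supporting functionals and the numerical radius\<close>

lemma is_normD:
  assumes "is_norm N"
  shows norm_ge_0: "0 \<le> N x" and norm_eq_0: "N x = 0 \<longleftrightarrow> x = 0"
    and norm_scale: "N (c *\<^sub>R x) = \<bar>c\<bar> * N x" and norm_triangle: "N (x + y) \<le> N x + N y"
  using assms unfolding is_norm_def by blast+

lemma seminorm_bound_from_ball: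
  assumes N: "is_norm N"
    and scale: "\<And>c x. M (c *\<^sub>R x) = \<bar>c\<bar> * (M x :: real)"
    and ball: "\<And>x. x \<in> unit_ball N \<Longrightarrow> M x \<le> K"
  shows "M x \<le> K * N x"
proof (cases "x = 0")
  case True
  then show ?thesis using scale[of 0 x] norm_eq_0[OF N, of x] by simp
next
  case False
  then have pos: "N x > 0"
    using norm_ge_0[OF N, of x] norm_eq_0[OF N, of x] by linarith
  have "N ((1 / N x) *\<^sub>R x) = 1"
    using pos by (simp add: norm_scale[OF N])
  then have "M ((1 / N x) *\<^sub>R x) \<le> K"
    by (intro ball) (simp add: unit_ball_def)
  then show ?thesis
    using pos by (simp add: scale field_simps)
qed

lemma convex_sublevel:
  assumes N: "is_norm N" and T: "linear T"
  shows "convex {x. N (T x) \<le> K}"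
proof (rule convexI)
  fix x y and u v :: real
  assume x: "x \<in> {x. N (T x) \<le> K}" and y: "y \<in> {x. N (T x) \<le> K}"
    and uv: "0 \<le> u" "0 \<le> v" "u + v = 1"
  have "N (T (u *\<^sub>R x + v *\<^sub>R y)) \<le> N (u *\<^sub>R T x) + N (v *\<^sub>R T y)"
    by (simp add: linear_add[OF T] linear_scale[OF T] norm_triangle[OF N])
  also have "\<dots> = u * N (T x) + v * N (T y)"
    using uv by (simp add: norm_scale[OF N])
  also have "\<dots> \<le> u * K + v * K"
    using x y uv by (intro add_mono mult_left_mono) auto
  also have "\<dots> = K"
    using uv by (simp flip: distrib_right)
  finally show "u *\<^sub>R x + v *\<^sub>R y \<in> {x. N (T x) \<le> K}" by simp
qed

lemma convex_abs_le:
  fixes f :: "'a::real_vector \<Rightarrow> real"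
  assumes "linear f"
  shows "convex {x. \<bar>f x\<bar> \<le> c}"
proof -
  have "{x. \<bar>f x\<bar> \<le> c} = f -` {- c..c}" by (auto simp: abs_le_iff)
  then show ?thesis using convex_linear_vimage[OF assms] by simp
qed

lemma operator_bound_from_vertices:
  assumes N: "is_norm N" and T: "linear T"
    and hull: "unit_ball N = convex hull V"
    and vertices: "\<And>v. v \<in> V \<Longrightarrow> N (T v) \<le> K"
  shows "N (T x) \<le> K * N x"
proof (rule seminorm_bound_from_ball[OF N, where M = "\<lambda>x. N (T x)"])
  show "N (T (c *\<^sub>R x)) = \<bar>c\<bar> * N (T x)" for c x
    by (simp add: linear_scale[OF T] norm_scale[OF N])
  have "convex hull V \<subseteq> {x. N (T x) \<le> K}"
    using vertices by (intro hull_minimal convex_sublevel[OF N T]) auto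
  then show "N (T x) \<le> K" if "x \<in> unit_ball N" for x
    using that hull by auto
qed

lemma dual_norm_1_bound:
  assumes N: "is_norm N" and f: "f \<in> dual_space N" "dual_norm N f = 1"
  shows "\<bar>f x\<bar> \<le> N x"
proof -
  from f(1) obtain K where lin: "linear f" and K: "\<And>x. \<bar>f x\<bar> \<le> K * N x"
    unfolding dual_space_def bounded_operators_def by auto
  have bdd: "bdd_above ((\<lambda>x. \<bar>f x\<bar>) ` unit_ball N)"
  proof (rule bdd_aboveI2)
    fix x assume "x \<in> unit_ball N"
    then have "N x \<le> 1" by (simp add: unit_ball_def)
    have "\<bar>f x\<bar> \<le> \<bar>K\<bar> * N x"
      using K[of x] mult_right_mono[OF abs_ge_self[of K] norm_ge_0[OF N, of x]] by linarith
    also have "\<dots> \<le> \<bar>K\<bar>"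
      using \<open>N x \<le> 1\<close> by (simp add: mult_left_le)
    finally show "\<bar>f x\<bar> \<le> \<bar>K\<bar>" .
  qed
  have "\<bar>f x\<bar> \<le> 1 * N x"
  proof (rule seminorm_bound_from_ball[OF N, where M = "\<lambda>x. \<bar>f x\<bar>"])
    show "\<bar>f (c *\<^sub>R x)\<bar> = \<bar>c\<bar> * \<bar>f x\<bar>" for c x
      by (simp add: linear_scale[OF lin] abs_mult)
    show "\<bar>f x\<bar> \<le> 1" if "x \<in> unit_ball N" for x
      using cSUP_upper[OF that bdd] f(2) unfolding dual_norm_def operator_norm_def by simp
  qed
  then show ?thesis by simp
qed

text \<open>
  This turns a facet functional and a point of the facet into a pair over which the numerical radius
  is taken; the condition on the dual norm becomes an estimate on the ball.
\<close>

lemma supporting_functional: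
  assumes N: "is_norm N" and lin: "linear f"
    and ball: "\<And>y. y \<in> unit_ball N \<Longrightarrow> \<bar>f y\<bar> \<le> 1"
    and x: "x \<in> unit_ball N" "f x = 1"
  shows "x \<in> unit_sphere N" "f \<in> dual_space N" "dual_norm N f = 1"
proof -
  have bound: "\<bar>f y\<bar> \<le> 1 * N y" for y
  proof (rule seminorm_bound_from_ball[OF N, where M = "\<lambda>x. \<bar>f x\<bar>"])
    show "\<bar>f (c *\<^sub>R x)\<bar> = \<bar>c\<bar> * \<bar>f x\<bar>" for c x
      by (simp add: linear_scale[OF lin] abs_mult)
  qed (rule ball)
  show "x \<in> unit_sphere N"
    using bound[of x] x by (simp add: unit_ball_def unit_sphere_def)
  show "f \<in> dual_space N"
    using lin bound unfolding dual_space_def bounded_operators_def by blast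
  have "(SUP x\<in>unit_ball N. \<bar>f x\<bar>) = 1"
  proof (rule cSup_eq_maximum)
    show "1 \<in> (\<lambda>x. \<bar>f x\<bar>) ` unit_ball N"
      using x by (intro image_eqI[of _ _ x]) auto
  qed (use ball in auto)
  then show "dual_norm N f = 1"
    unfolding dual_norm_def operator_norm_def .
qed

lemma numerical_radius_lower:
  assumes N: "is_norm N" and T: "T \<in> bounded_operators N N"
    and lin: "linear f" and ball: "\<And>y. y \<in> unit_ball N \<Longrightarrow> \<bar>f y\<bar> \<le> 1"
    and x: "x \<in> unit_ball N" "f x = 1"
  shows "\<bar>f (T x)\<bar> \<le> numerical_radius N T"
  unfolding numerical_radius_def
proof (rule cSup_upper)
  note supp = supporting_functional[OF N lin ball x]
  show "\<bar>f (T x)\<bar> \<in> {\<bar>f (T x)\<bar> | x f. x \<in> unit_sphere N \<and> f \<in> dual_space N \<and>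
      dual_norm N f = 1 \<and> f x = 1}"
    using supp x by blast
  from T obtain K where K: "\<And>x. N (T x) \<le> K * N x"
    unfolding bounded_operators_def by auto
  show "bdd_above {\<bar>f (T x)\<bar> | x f. x \<in> unit_sphere N \<and> f \<in> dual_space N \<and>
      dual_norm N f = 1 \<and> f x = 1}"
  proof (rule bdd_aboveI)
    fix r assume "r \<in> {\<bar>f (T x)\<bar> | x f. x \<in> unit_sphere N \<and> f \<in> dual_space N \<and>
      dual_norm N f = 1 \<and> f x = 1}"
    then obtain x f where r: "r = \<bar>f (T x)\<bar>" "N x = 1" "f \<in> dual_space N" "dual_norm N f = 1"
      unfolding unit_sphere_def by auto
    show "r \<le> K"
      using dual_norm_1_bound[OF N r(3,4), of "T x"] K[of x] r(1,2) by simp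
  qed
qed

text \<open>
  If \<open>c I + s T\<close> and \<open>c I - s T\<close> are contractions, evaluating them at a pair with \<open>f x = 1\<close> gives
  \<open>c + s f (T x) \<le> 1\<close> and \<open>c - s f (T x) \<le> 1\<close>.  With
  \<open>T\<close> the quarter turn of the plane and \<open>c\<close>, \<open>s\<close> the cosine and sine of the smallest rotational
  symmetry of a regular \<open>2n\<close>-gon the resulting bound is sharp, and the functionals supporting the ball
  never have to be described.
\<close>

lemma numerical_radius_upper_of_contractions:
  assumes N: "is_norm N" and s: "0 < s"
    and plus: "\<And>x. N (c *\<^sub>R x + s *\<^sub>R T x) \<le> N x"
    and minus: "\<And>x. N (c *\<^sub>R x - s *\<^sub>R T x) \<le> N x"
    and pair: "x\<^sub>0 \<in> unit_sphere N" "f\<^sub>0 \<in> dual_space N" "dual_norm N f\<^sub>0 = 1" "f\<^sub>0 x\<^sub>0 = 1"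
  shows "numerical_radius N T \<le> (1 - c) / s"
  unfolding numerical_radius_def
proof (rule cSup_least)
  show "{\<bar>f (T x)\<bar> | x f. x \<in> unit_sphere N \<and> f \<in> dual_space N \<and>
      dual_norm N f = 1 \<and> f x = 1} \<noteq> {}"
    using pair by blast
  fix r assume "r \<in> {\<bar>f (T x)\<bar> | x f. x \<in> unit_sphere N \<and> f \<in> dual_space N \<and>
      dual_norm N f = 1 \<and> f x = 1}"
  then obtain x f where r: "r = \<bar>f (T x)\<bar>" and x: "N x = 1" "f x = 1"
    and f: "f \<in> dual_space N" "dual_norm N f = 1"
    unfolding unit_sphere_def by auto
  have lin: "linear f"
    using f(1) unfolding dual_space_def bounded_operators_def by auto
  have "f (c *\<^sub>R x + s *\<^sub>R T x) \<le> 1" "f (c *\<^sub>R x - s *\<^sub>R T x) \<le> 1"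
    using dual_norm_1_bound[OF N f, of "c *\<^sub>R x + s *\<^sub>R T x"] plus[of x]
      dual_norm_1_bound[OF N f, of "c *\<^sub>R x - s *\<^sub>R T x"] minus[of x] x by linarith+
  then have "c + s * f (T x) \<le> 1" "c - s * f (T x) \<le> 1"
    using x(2) by (simp_all add: linear_add[OF lin] linear_diff[OF lin] linear_scale[OF lin])
  then have "s * \<bar>f (T x)\<bar> \<le> 1 - c"
    by (simp add: abs_if)
  then show "r \<le> (1 - c) / s"
    using s r by (simp add: field_simps)
qed


section \<open>Operators on the plane and the regular polygon\<close>

text \<open>
  Modulo \<open>\<pi>\<close> an odd multiple of \<open>\<pi>/(2n)\<close> stays at distance at least \<open>\<pi>/(2n)\<close> from \<open>0\<close>.  Geometrically,
  no vertex of the \<open>2n\<close>-gon lies beyond the line through an edge.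
\<close>

lemma abs_cos_odd_multiple_le:
  fixes n :: nat and k :: int
  assumes "n > 0"
  shows "\<bar>cos ((2 * of_int k + 1) * pi / (2 * real n))\<bar> \<le> cos (pi / (2 * real n))"
proof -
  define m where "m = k mod int n"
  define q where "q = k div int n"
  have k: "k = q * int n + m" by (simp add: m_def q_def)
  have m: "0 \<le> m" "m + 1 \<le> int n" using assms pos_mod_bound[of "int n" k] unfolding m_def by (simp, linarith)
  define a where "a = pi / (2 * real n)"
  have na: "2 * real n * a = pi" using assms by (simp add: a_def)
  have a: "0 < a" using assms by (simp add: a_def)
  have m': "0 \<le> real_of_int m" "real_of_int m + 1 \<le> real n" using m by linarith+
  define x where "x = (2 * of_int m + 1) * a"
  have "(2 * of_int k + 1) * pi / (2 * real n) = (2 * of_int k + 1) * a" by (simp add: a_def)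
  also have "\<dots> = x + pi * of_int q"
    unfolding k x_def na[symmetric] by (simp add: algebra_simps)
  finally have "\<bar>cos ((2 * of_int k + 1) * pi / (2 * real n))\<bar> = \<bar>cos x\<bar>"
    by (simp add: cos_add sin_npi_int cos_npi_int)
  also have "\<dots> \<le> cos a"
  proof -
    have "a \<le> x" using m' a unfolding x_def by (simp add: algebra_simps)
    moreover have "x \<le> pi - a"
      using mult_right_mono[OF m'(2), of "2 * a"] a unfolding x_def na[symmetric]
      by (simp add: algebra_simps)
    ultimately have "cos x \<le> cos a" "cos (pi - a) \<le> cos x"
      using a by (intro cos_monotone_0_pi_le; linarith)+
    then show ?thesis by (simp add: abs_le_iff)
  qed
  finally show ?thesis by (simp add: a_def)
qed

text \<open>
  For even \<open>n\<close> the right angle is an even multiple of \<open>\<pi>/(2n)\<close>, so complementary angles of odd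
  multiples are odd multiples.  For odd \<open>n\<close> the right angle is itself an odd multiple, with sine 1.
\<close>

lemma abs_sin_odd_multiple_le:
  fixes n :: nat and k :: int
  assumes "even n" "n > 0"
  shows "\<bar>sin ((2 * of_int k + 1) * pi / (2 * real n))\<bar> \<le> cos (pi / (2 * real n))"
proof -
  obtain m where m: "n = 2 * m" using assms(1) by blast
  have "pi / 2 - (2 * of_int k + 1) * pi / (2 * real n)
      = (2 * of_int (int m - k - 1) + 1) * pi / (2 * real n)"
    using assms(2) by (simp add: m field_simps)
  then show ?thesis
    using abs_cos_odd_multiple_le[OF assms(2), of "int m - k - 1"]
    by (simp add: sin_cos_eq)
qed

text \<open>
  The matrix with rows \<open>(a, b)\<close> and \<open>(c, d)\<close>, applied to the unit vector at angle \<open>\<phi>\<close> and paired with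
  the unit vector at angle \<open>\<theta>\<close>.
\<close>

definition plane_form :: "real \<Rightarrow> real \<Rightarrow> real \<Rightarrow> real \<Rightarrow> real \<Rightarrow> real \<Rightarrow> real" where
  "plane_form a b c d \<theta> \<phi> =
     cos \<theta> * (a * cos \<phi> + b * sin \<phi>) + sin \<theta> * (c * cos \<phi> + d * sin \<phi>)"

text \<open>
  Every \<open>2 \<times> 2\<close> matrix is a multiple of the identity, plus a multiple of the quarter turn, plus a
  symmetric traceless matrix, that is, a multiple of a reflection.
\<close>

lemma plane_form_decomposition:
  obtains p q r \<psi> where "r \<ge> 0"
    "\<And>\<theta> \<phi>. plane_form a b c d \<theta> \<phi> =
       p * cos (\<theta> - \<phi>) + q * sin (\<theta> - \<phi>) + r * cos (\<theta> + \<phi> - \<psi>)"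
proof -
  define z where "z = Complex ((a - d) / 2) ((b + c) / 2)"
  have z: "(a - d) / 2 = cmod z * cos (Arg z)" "(b + c) / 2 = cmod z * sin (Arg z)"
    using Re_rcis[of "cmod z" "Arg z"] Im_rcis[of "cmod z" "Arg z"]
    by (simp_all add: rcis_cmod_Arg z_def)
  have "plane_form a b c d \<theta> \<phi> = (a + d) / 2 * cos (\<theta> - \<phi>) + (c - b) / 2 * sin (\<theta> - \<phi>)
      + cmod z * cos (\<theta> + \<phi> - Arg z)" for \<theta> \<phi>
  proof -
    have "cmod z * cos (\<theta> + \<phi> - Arg z) = (a - d) / 2 * cos (\<theta> + \<phi>) + (b + c) / 2 * sin (\<theta> + \<phi>)"
      unfolding z by (simp add: cos_diff algebra_simps)
    then show ?thesis
      by (simp add: plane_form_def cos_add sin_add cos_diff sin_diff field_simps)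
  qed
  then show ?thesis by (intro that[of "cmod z" "(a + d) / 2" "(c - b) / 2" "Arg z"]) auto
qed

text \<open>
  The planar heart of the lower bound: a bound at the incident vertex-edge pairs controls all pairs,
  with the loss of a factor \<open>cot \<alpha>\<close>.  The terms in \<open>p\<close> and \<open>q\<close> depend only on the difference of the two
  angles, whereas moving along the polygon with that difference fixed turns the argument of the
  \<open>r\<close>-term in steps of \<open>4\<alpha>\<close>.  Hence that argument can be brought within \<open>2\<alpha>\<close> of zero or of \<open>\<pi>\<close>, with
  either sign, so that it cannot cancel the other two terms.  The estimate \<open>sin \<alpha> \<le> cos \<alpha> cos 2\<alpha>\<close>
  that finishes the comparison is false for the square, \<open>n = 2\<close>, where however each vertex lies on
  each edge up to sign.
\<close>

lemma plane_form_bound: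
  fixes n :: nat
  assumes n: "even n" "n > 0"
    and succ: "\<And>j::int. \<bar>plane_form a b c d (of_int j * pi / n + pi / (2 * real n)) (of_int j * pi / n)\<bar> \<le> V"
    and pred: "\<And>j::int. \<bar>plane_form a b c d (of_int j * pi / n - pi / (2 * real n)) (of_int j * pi / n)\<bar> \<le> V"
  shows "\<bar>plane_form a b c d ((2 * of_int k + 1) * pi / (2 * real n)) (of_int j * pi / n)\<bar> * tan (pi / (2 * real n)) \<le> V"
proof (cases "n = 2")
  case True
  \<comment> \<open>Up to a half turn of the normal, which only changes the sign, every edge is one of the two
    incident with the vertex.\<close>
  have "\<exists>q::int. k - j = 2 * q \<or> k - j = 2 * q - 1" by presburger
  then obtain q where "k - j = 2 * q \<or> k - j = 2 * q - 1" ..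
  then consider "k = j + 2 * q" | "k = j + 2 * q - 1" by linarith
  then have "(2 * of_int k + 1) * pi / (2 * real n) = of_int j * pi / n + pi / (2 * real n) + pi * of_int q
     \<or> (2 * of_int k + 1) * pi / (2 * real n) = of_int j * pi / n - pi / (2 * real n) + pi * of_int q"
  proof cases
    case 1
    show ?thesis unfolding 1 True by (simp add: field_simps)
  next
    case 2
    show ?thesis unfolding 2 True by (simp add: field_simps)
  qed
  moreover have "\<bar>plane_form a b c d (\<theta> + pi * of_int q) \<phi>\<bar> = \<bar>plane_form a b c d \<theta> \<phi>\<bar>" for \<theta> \<phi>
    by (cases "even q") (simp_all add: plane_form_def cos_add sin_add cos_npi_int sin_npi_int abs_if)
  ultimately have "\<bar>plane_form a b c d ((2 * of_int k + 1) * pi / (2 * real n)) (of_int j * pi / n)\<bar> \<le> V"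
    using succ[of j] pred[of j] by auto
  then show ?thesis by (simp add: True tan_45)
next
  case False
  obtain m where m: "n = 2 * m" using n(1) by blast
  have n4: "n \<ge> 4" using False n m by simp
  define \<alpha> where "\<alpha> = pi / (2 * real n)"
  have na: "2 * real n * \<alpha> = pi" using n by (simp add: \<alpha>_def)
  have \<alpha>0: "0 < \<alpha>" using n by (simp add: \<alpha>_def)
  have "8 * \<alpha> \<le> 2 * real n * \<alpha>" using n4 \<alpha>0 by (intro mult_right_mono) auto
  then have \<alpha>8: "2 * \<alpha> \<le> pi / 4" using na by simp
  have angle: "of_int j * pi / n = of_int j * (2 * \<alpha>)" for j :: int
    by (simp add: \<alpha>_def)
  have sin0: "0 < sin \<alpha>" and cos0: "0 < cos \<alpha>"
    using \<alpha>0 \<alpha>8 by (auto intro!: sin_gt_zero cos_gt_zero)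
  obtain p q r \<psi> where r: "r \<ge> 0" and dec: "\<And>\<theta> \<phi>. plane_form a b c d \<theta> \<phi> =
       p * cos (\<theta> - \<phi>) + q * sin (\<theta> - \<phi>) + r * cos (\<theta> + \<phi> - \<psi>)"
    by (rule plane_form_decomposition) blast
  have key: "\<bar>p\<bar> * cos \<alpha> + \<bar>q\<bar> * sin \<alpha> + r * cos (2 * \<alpha>) \<le> V"
  proof -
    \<comment> \<open>The neighbouring edge for which the \<open>p\<close>- and \<open>q\<close>-terms have the same sign.\<close>
    define \<sigma> :: real where "\<sigma> = (if p * q \<ge> 0 then 1 else - 1)"
    have \<sigma>: "\<sigma> = 1 \<or> \<sigma> = - 1" by (simp add: \<sigma>_def)
    have incident: "\<bar>p * cos \<alpha> + \<sigma> * q * sin \<alpha> + r * cos (of_int j * (4 * \<alpha>) + \<sigma> * \<alpha> - \<psi>)\<bar> \<le> V"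
      for j :: int
      using \<sigma> succ[of j] pred[of j]
      unfolding dec angle \<alpha>_def[symmetric] by (auto simp: algebra_simps)
    have abs_sum: "\<bar>p * cos \<alpha> + \<sigma> * q * sin \<alpha>\<bar> = \<bar>p\<bar> * cos \<alpha> + \<bar>q\<bar> * sin \<alpha>"
    proof -
      have same_sign: "\<bar>x + y\<bar> = \<bar>x\<bar> + \<bar>y\<bar>" if "0 \<le> x * y" for x y :: real
        using that by (auto simp: zero_le_mult_iff)
      have "0 \<le> \<sigma> * (p * q)" by (simp add: \<sigma>_def)
      then have "0 \<le> (\<sigma> * (p * q)) * (cos \<alpha> * sin \<alpha>)"
        using sin0 cos0 by (metis less_imp_le mult_nonneg_nonneg)
      then have "0 \<le> (p * cos \<alpha>) * (\<sigma> * q * sin \<alpha>)" by (simp add: mult_ac)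
      then have "\<bar>p * cos \<alpha> + \<sigma> * q * sin \<alpha>\<bar> = \<bar>p * cos \<alpha>\<bar> + \<bar>\<sigma> * q * sin \<alpha>\<bar>"
        by (rule same_sign)
      then show ?thesis
        using sin0 cos0 \<sigma> by (auto simp: abs_mult)
    qed
    \<comment> \<open>The arguments of the \<open>r\<close>-term have spacing \<open>4\<alpha>\<close>; the one nearest zero is within \<open>2\<alpha>\<close>.\<close>
    define i where "i = round ((\<psi> - \<sigma> * \<alpha>) / (4 * \<alpha>))"
    define \<delta> where "\<delta> = of_int i * (4 * \<alpha>) + \<sigma> * \<alpha> - \<psi>"
    have "\<bar>of_int i - (\<psi> - \<sigma> * \<alpha>) / (4 * \<alpha>)\<bar> \<le> 1 / 2"
      unfolding i_def by (rule of_int_round_abs_le)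
    then have "\<bar>of_int i - (\<psi> - \<sigma> * \<alpha>) / (4 * \<alpha>)\<bar> * (4 * \<alpha>) \<le> 1 / 2 * (4 * \<alpha>)"
      using \<alpha>0 by (intro mult_right_mono) auto
    also have "\<bar>of_int i - (\<psi> - \<sigma> * \<alpha>) / (4 * \<alpha>)\<bar> * (4 * \<alpha>)
        = \<bar>(of_int i - (\<psi> - \<sigma> * \<alpha>) / (4 * \<alpha>)) * (4 * \<alpha>)\<bar>"
      using \<alpha>0 by (simp add: abs_mult)
    also have "(of_int i - (\<psi> - \<sigma> * \<alpha>) / (4 * \<alpha>)) * (4 * \<alpha>) = \<delta>"
      using \<alpha>0 by (simp add: \<delta>_def field_simps)
    finally have "\<bar>\<delta>\<bar> \<le> 2 * \<alpha>" by simp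
    then have "cos (2 * \<alpha>) \<le> cos \<bar>\<delta>\<bar>"
      using \<alpha>8 pi_gt_zero by (intro cos_monotone_0_pi_le) linarith+
    then have cos\<delta>: "cos (2 * \<alpha>) \<le> cos \<delta>" by simp
    \<comment> \<open>Moving \<open>n/2\<close> vertices further shifts the argument by \<open>\<pi>\<close> and flips the sign of the \<open>r\<close>-term.\<close>
    have "of_int (i + int m) * (4 * \<alpha>) + \<sigma> * \<alpha> - \<psi> = \<delta> + pi"
      unfolding na[symmetric] \<delta>_def m by (simp add: algebra_simps)
    then have "\<bar>p * cos \<alpha> + \<sigma> * q * sin \<alpha> - r * cos \<delta>\<bar> \<le> V"
      using incident[of "i + int m"] by simp
    moreover have "\<bar>p * cos \<alpha> + \<sigma> * q * sin \<alpha> + r * cos \<delta>\<bar> \<le> V"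
      using incident[of i] by (simp add: \<delta>_def)
    ultimately have "\<bar>p * cos \<alpha> + \<sigma> * q * sin \<alpha>\<bar> + r * cos \<delta> \<le> V"
      by linarith
    then show ?thesis
      using abs_sum mult_left_mono[OF cos\<delta> r] by linarith
  qed
  have cs: "sin \<alpha> \<le> cos \<alpha> * cos (2 * \<alpha>)"
  proof -
    have c2: "0 \<le> cos (2 * \<alpha>)" using \<alpha>0 \<alpha>8 by (intro cos_ge_zero) auto
    have "sin (2 * \<alpha>) \<le> sin (pi / 4)" using \<alpha>0 \<alpha>8 by (intro sin_monotone_2pi_le) auto
    also have "\<dots> = cos (pi / 4)" by (simp add: sin_45 cos_45)
    also have "\<dots> \<le> cos (2 * \<alpha>)" using \<alpha>0 \<alpha>8 by (intro cos_monotone_0_pi_le) auto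
    finally have "2 * sin \<alpha> * cos \<alpha> \<le> cos (2 * \<alpha>)" by (simp add: sin_double)
    then have "2 * sin \<alpha> * cos \<alpha> * cos \<alpha> \<le> cos (2 * \<alpha>) * cos \<alpha>"
      using cos0 by (intro mult_right_mono) auto
    moreover have "2 * sin \<alpha> * cos \<alpha> * cos \<alpha> = sin \<alpha> * (1 + cos (2 * \<alpha>))"
      unfolding cos_double_cos power2_eq_square by (simp add: algebra_simps)
    moreover have "sin \<alpha> \<le> sin \<alpha> * (1 + cos (2 * \<alpha>))"
      using sin0 c2 by simp
    ultimately show ?thesis
      unfolding mult.commute[of "cos (2 * \<alpha>)" "cos \<alpha>"] by linarith
  qed
  have sc: "sin \<alpha> \<le> cos \<alpha>"
    using cs mult_left_mono[OF cos_le_one[of "2 * \<alpha>"] less_imp_le[OF cos0]] by linarith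
  define \<beta> where "\<beta> = (2 * of_int k + 1) * pi / (2 * real n) - of_int j * pi / n"
  have \<beta>: "\<beta> = (2 * of_int (k - j) + 1) * pi / (2 * real n)"
    using n by (simp add: \<beta>_def field_simps)
  have "\<bar>cos \<beta>\<bar> \<le> cos \<alpha>" "\<bar>sin \<beta>\<bar> \<le> cos \<alpha>"
    unfolding \<beta> \<alpha>_def
    by (rule abs_cos_odd_multiple_le[OF n(2)], rule abs_sin_odd_multiple_le[OF n])
  then have "\<bar>p * cos \<beta>\<bar> \<le> \<bar>p\<bar> * cos \<alpha>" "\<bar>q * sin \<beta>\<bar> \<le> \<bar>q\<bar> * cos \<alpha>"
    unfolding abs_mult by (auto intro: mult_left_mono)
  moreover have "\<bar>r * cos \<gamma>\<bar> \<le> r" for \<gamma>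
    unfolding abs_mult using r abs_cos_le_one[of \<gamma>] by (simp add: mult_left_le)
  ultimately have "\<bar>plane_form a b c d ((2 * of_int k + 1) * pi / (2 * real n)) (of_int j * pi / n)\<bar>
      \<le> \<bar>p\<bar> * cos \<alpha> + \<bar>q\<bar> * cos \<alpha> + r"
    unfolding dec \<beta>_def[symmetric]
    by (smt (verit, best))
  then have "\<bar>plane_form a b c d ((2 * of_int k + 1) * pi / (2 * real n)) (of_int j * pi / n)\<bar> * tan \<alpha>
      \<le> (\<bar>p\<bar> * cos \<alpha> + \<bar>q\<bar> * cos \<alpha> + r) * tan \<alpha>"
    using sin0 cos0 by (intro mult_right_mono) (auto simp: tan_def)
  also have "\<dots> = \<bar>p\<bar> * sin \<alpha> + \<bar>q\<bar> * sin \<alpha> + r * (sin \<alpha> / cos \<alpha>)"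
    using cos0 by (simp add: tan_def field_simps)
  also have "\<dots> \<le> \<bar>p\<bar> * cos \<alpha> + \<bar>q\<bar> * sin \<alpha> + r * cos (2 * \<alpha>)"
  proof -
    have "sin \<alpha> / cos \<alpha> \<le> cos (2 * \<alpha>)" using cs cos0 by (simp add: field_simps)
    then show ?thesis using r sc by (intro add_mono mult_left_mono) auto
  qed
  also note key
  finally show ?thesis by (simp add: \<alpha>_def)
qed


section \<open>The prism\<close>

text \<open>
  Vertices have \<open>s = \<plusminus>1\<close>; intermediate heights \<open>s\<close> describe the vertical edges, and a general angle
  the oblique cylinder circumscribed about the prism.
\<close>

definition prism_point :: "real \<Rightarrow> real \<Rightarrow> real \<Rightarrow> real^3" where
  "prism_point l \<phi> s = vector [cos \<phi> + s * l, sin \<phi>, s]"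

text \<open>
  The outward normal of a lateral facet in the coordinates of the right prism, scaled so that its
  maximum on the circumscribed cylinder is 1; on the facet itself its value is \<open>cos (\<pi>/(2n))\<close>.
\<close>

definition lateral_form :: "real \<Rightarrow> real \<Rightarrow> real^3 \<Rightarrow> real" where
  "lateral_form l \<theta> y = cos \<theta> * (y$1 - l * y$3) + sin \<theta> * y$2"

lemma prism_point_nth [simp]:
  "prism_point l \<phi> s $ 1 = cos \<phi> + s * l" "prism_point l \<phi> s $ 2 = sin \<phi>"
  "prism_point l \<phi> s $ 3 = s"
  by (simp_all add: prism_point_def)

lemma lateral_form_prism_point: "lateral_form l \<theta> (prism_point l \<phi> s) = cos (\<theta> - \<phi>)"
  by (simp add: lateral_form_def cos_diff)

lemma linear_lateral_form: "linear (lateral_form l \<theta>)"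
  by (rule linearI) (simp_all add: lateral_form_def algebra_simps)

lemma prism_vertices_eq:
  assumes "n > 0"
  shows "prism_vertices n l = {prism_point l (of_int j * pi / n) s | j s. s = 1 \<or> s = -1}"
proof (intro equalityI subsetI)
  fix x assume "x \<in> prism_vertices n l"
  then obtain j where j: "j \<in> {1..2 * n}" and
    x: "x = vector [cos ((real j - 1) * pi / real n) + l, sin ((real j - 1) * pi / real n), 1] \<or>
     x = vector [cos ((real j - 1) * pi / real n) - l, sin ((real j - 1) * pi / real n), - 1]"
    unfolding prism_vertices_def by auto
  from x have "x = prism_point l (of_int (int j - 1) * pi / n) 1 \<or>
     x = prism_point l (of_int (int j - 1) * pi / n) (-1)"
    by (auto simp: prism_point_def)
  then show "x \<in> {prism_point l (of_int j * pi / n) s | j s. s = 1 \<or> s = -1}" by blast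
next
  fix x assume "x \<in> {prism_point l (of_int j * pi / n) s | j s. s = 1 \<or> s = -1}"
  then obtain j s where x: "x = prism_point l (of_int j * pi / n) s" and s: "s = 1 \<or> s = -1"
    by blast
  define i where "i = nat (j mod (2 * int n)) + 1"
  define q where "q = j div (2 * int n)"
  have "0 \<le> j mod (2 * int n)" "j mod (2 * int n) < 2 * int n" using assms by simp_all
  then have i: "i \<in> {1..2 * n}" and i': "int i = j mod (2 * int n) + 1"
    unfolding i_def by auto
  have "j = int i - 1 + q * (2 * int n)" unfolding i' q_def
    using div_mult_mod_eq[of j "2 * int n"] by linarith
  then have j: "real_of_int j = real i - 1 + of_int q * (2 * real n)" by simp
  have "of_int j * pi / n = (real i - 1) * pi / n + 2 * pi * of_int q"
    unfolding j using assms by (simp add: field_simps)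
  then have "cos (of_int j * pi / n) = cos ((real i - 1) * pi / n)"
      "sin (of_int j * pi / n) = sin ((real i - 1) * pi / n)"
    by (simp_all add: cos_add sin_add)
  then show "x \<in> prism_vertices n l"
    unfolding prism_vertices_def x prism_point_def using i s by auto
qed

locale prism_norm =
  fixes N :: "real^3 \<Rightarrow> real" and l :: real and n :: nat
  assumes even_n: "even n" and pos_n: "n > 0" and N: "is_norm N"
    and ball: "unit_ball N = convex hull (prism_vertices n l)"
begin

lemma prism_point_in_ball:
  assumes "\<bar>s\<bar> \<le> 1"
  shows "prism_point l (of_int j * pi / n) s \<in> unit_ball N"
proof -
  let ?P = "prism_point l (of_int j * pi / n)"
  have "?P 1 \<in> unit_ball N" "?P (-1) \<in> unit_ball N"
    unfolding ball prism_vertices_eq[OF pos_n] by (auto intro!: hull_inc)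
  moreover have "convex (unit_ball N)" unfolding ball by (rule convex_convex_hull)
  ultimately have "((1 + s) / 2) *\<^sub>R ?P 1 + ((1 - s) / 2) *\<^sub>R ?P (-1) \<in> unit_ball N"
    using assms by (intro convexD) (auto simp: field_simps)
  also have "((1 + s) / 2) *\<^sub>R ?P 1 + ((1 - s) / 2) *\<^sub>R ?P (-1) = ?P s"
    by (simp add: vec_eq_iff forall_3 field_simps)
  finally show ?thesis .
qed

lemma lateral_form_le:
  assumes "y \<in> unit_ball N"
  shows "\<bar>lateral_form l ((2 * of_int k + 1) * pi / (2 * real n)) y\<bar> \<le> cos (pi / (2 * real n))"
proof -
  let ?f = "lateral_form l ((2 * of_int k + 1) * pi / (2 * real n))"
  have "convex {y. \<bar>?f y\<bar> \<le> cos (pi / (2 * real n))}"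
    by (rule convex_abs_le[OF linear_lateral_form])
  moreover have "\<bar>?f (prism_point l (of_int j * pi / n) s)\<bar> \<le> cos (pi / (2 * real n))" for j s
  proof -
    have "(2 * of_int k + 1) * pi / (2 * real n) - of_int j * pi / n =
        (2 * of_int (k - j) + 1) * pi / (2 * real n)"
      using pos_n by (simp add: field_simps)
    then show ?thesis
      using abs_cos_odd_multiple_le[OF pos_n, of "k - j"]
      by (simp only: lateral_form_prism_point)
  qed
  ultimately have "unit_ball N \<subseteq> {y. \<bar>?f y\<bar> \<le> cos (pi / (2 * real n))}"
    unfolding ball prism_vertices_eq[OF pos_n] by (intro hull_minimal) auto
  then show ?thesis using assms by blast
qed

lemma height_le:
  assumes "y \<in> unit_ball N"
  shows "\<bar>y$3\<bar> \<le> 1"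
proof -
  have "convex {y::real^3. \<bar>y$3\<bar> \<le> 1}"
    by (rule convex_abs_le[OF bounded_linear.linear[OF bounded_linear_vec_nth]])
  then have "unit_ball N \<subseteq> {y. \<bar>y$3\<bar> \<le> 1}"
    unfolding ball prism_vertices_eq[OF pos_n] by (intro hull_minimal) auto
  then show ?thesis using assms by blast
qed

lemma half_angle: "0 < pi / (2 * real n)" "pi / (2 * real n) \<le> pi / 4"
proof -
  have "n \<ge> 2" using even_n pos_n by (cases "n = 1") auto
  then show "0 < pi / (2 * real n)" "pi / (2 * real n) \<le> pi / 4"
    by (auto simp: field_simps)
qed

lemma sin_half_angle: "0 < sin (pi / (2 * real n))"
  and cos_half_angle: "0 < cos (pi / (2 * real n))"
  and tan_half_angle: "0 < tan (pi / (2 * real n))"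
  using half_angle pi_gt_zero by (auto intro!: sin_gt_zero cos_gt_zero tan_gt_zero)

text \<open>
  In the horizontal slice through \<open>y\<close>, the point lies in the angular sector between two consecutive
  vertices of the polygon, hence is a nonnegative combination of them; the facet over the edge joining
  them says that the two weights add up to at most 1.  The missing weight goes to the centre of the
  slice, the midpoint of two antipodal vertices.
\<close>

lemma facets_determine_ball:
  assumes lateral: "\<And>k::int. \<bar>lateral_form l ((2 * of_int k + 1) * pi / (2 * real n)) y\<bar> \<le> cos (pi / (2 * real n))"
    and height: "\<bar>y$3\<bar> \<le> 1"
  shows "y \<in> unit_ball N"
proof -
  define \<alpha> where "\<alpha> = pi / (2 * real n)"
  have \<alpha>: "0 < \<alpha>" "2 * \<alpha> \<le> pi / 2" using half_angle unfolding \<alpha>_def by linarith+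
  have na: "2 * real n * \<alpha> = pi" using pos_n by (simp add: \<alpha>_def)
  have ca: "0 < cos \<alpha>" and sa: "0 < sin \<alpha>"
    using cos_half_angle sin_half_angle by (simp_all add: \<alpha>_def)
  define s where "s = y$3"
  define z where "z = Complex (y$1 - l * s) (y$2)"
  define \<rho> where "\<rho> = cmod z"
  define \<phi> where "\<phi> = Arg z"
  have \<rho>0: "\<rho> \<ge> 0" by (simp add: \<rho>_def)
  have y12: "y$1 = \<rho> * cos \<phi> + l * s" "y$2 = \<rho> * sin \<phi>"
    using Re_rcis[of "cmod z" "Arg z"] Im_rcis[of "cmod z" "Arg z"]
    by (simp_all add: rcis_cmod_Arg z_def \<rho>_def \<phi>_def)
  define j where "j = \<lfloor>\<phi> / (2 * \<alpha>)\<rfloor>"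
  define \<omega> where "\<omega> = of_int j * (2 * \<alpha>)"
  define \<tau> where "\<tau> = \<phi> - \<omega>"
  have "of_int j \<le> \<phi> / (2 * \<alpha>)" "\<phi> / (2 * \<alpha>) < of_int j + 1"
    unfolding j_def by linarith+
  then have \<tau>: "0 \<le> \<tau>" "\<tau> \<le> 2 * \<alpha>"
    using \<alpha> unfolding \<tau>_def \<omega>_def by (simp_all add: field_simps)
  have \<phi>: "\<phi> = \<omega> + \<tau>" by (simp add: \<tau>_def)
  have s2: "sin (2 * \<alpha>) > 0" using ca sa by (simp add: sin_double)
  define u where "u = \<rho> * sin (2 * \<alpha> - \<tau>) / sin (2 * \<alpha>)"
  define v where "v = \<rho> * sin \<tau> / sin (2 * \<alpha>)"
  have u0: "0 \<le> u" and v0: "0 \<le> v"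
    using \<tau> \<alpha> s2 \<rho>0 unfolding u_def v_def
    by (auto intro!: divide_nonneg_pos mult_nonneg_nonneg sin_ge_zero)
  have id1: "sin (2 * \<alpha> - \<tau>) * cos \<omega> + sin \<tau> * cos (\<omega> + 2 * \<alpha>) = sin (2 * \<alpha>) * cos (\<omega> + \<tau>)"
    by (simp add: sin_diff cos_add algebra_simps)
  have id2: "sin (2 * \<alpha> - \<tau>) * sin \<omega> + sin \<tau> * sin (\<omega> + 2 * \<alpha>) = sin (2 * \<alpha>) * sin (\<omega> + \<tau>)"
    by (simp add: sin_diff sin_add algebra_simps)
  have dec: "u * cos \<omega> + v * cos (\<omega> + 2 * \<alpha>) = \<rho> * cos \<phi>"
    "u * sin \<omega> + v * sin (\<omega> + 2 * \<alpha>) = \<rho> * sin \<phi>"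
  proof -
    have "u * cos \<omega> + v * cos (\<omega> + 2 * \<alpha>)
        = \<rho> * (sin (2 * \<alpha> - \<tau>) * cos \<omega> + sin \<tau> * cos (\<omega> + 2 * \<alpha>)) / sin (2 * \<alpha>)"
      by (simp add: u_def v_def add_divide_distrib algebra_simps)
    then show "u * cos \<omega> + v * cos (\<omega> + 2 * \<alpha>) = \<rho> * cos \<phi>"
      unfolding id1 \<phi> using s2 by simp
    have "u * sin \<omega> + v * sin (\<omega> + 2 * \<alpha>)
        = \<rho> * (sin (2 * \<alpha> - \<tau>) * sin \<omega> + sin \<tau> * sin (\<omega> + 2 * \<alpha>)) / sin (2 * \<alpha>)"
      by (simp add: u_def v_def add_divide_distrib algebra_simps)
    then show "u * sin \<omega> + v * sin (\<omega> + 2 * \<alpha>) = \<rho> * sin \<phi>"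
      unfolding id2 \<phi> using s2 by simp
  qed
  have uv: "u + v \<le> 1"
  proof -
    have "(u + v) * cos \<alpha> = u * cos \<alpha> + v * cos (- \<alpha>)" by (simp add: algebra_simps)
    also have "\<dots> = u * cos ((\<omega> + \<alpha>) - \<omega>) + v * cos ((\<omega> + \<alpha>) - (\<omega> + 2 * \<alpha>))" by simp
    also have "\<dots> = cos (\<omega> + \<alpha>) * (u * cos \<omega> + v * cos (\<omega> + 2 * \<alpha>))
        + sin (\<omega> + \<alpha>) * (u * sin \<omega> + v * sin (\<omega> + 2 * \<alpha>))"
      unfolding cos_diff by (simp add: algebra_simps)
    also have "\<dots> = lateral_form l (\<omega> + \<alpha>) y"
      unfolding dec by (simp add: lateral_form_def y12 s_def)
    also have "\<omega> + \<alpha> = (2 * of_int j + 1) * pi / (2 * real n)"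
      by (simp add: \<omega>_def \<alpha>_def field_simps add_divide_distrib)
    also have "lateral_form l \<dots> y \<le> cos \<alpha>"
      using lateral[of j] by (simp add: \<alpha>_def)
    finally show ?thesis using ca by simp
  qed
  have in_ball: "prism_point l (of_int i * (2 * \<alpha>)) s \<in> unit_ball N" for i :: int
    using prism_point_in_ball[of s i] height by (simp add: s_def \<alpha>_def)
  have 1: "prism_point l \<omega> s \<in> unit_ball N" using in_ball[of j] by (simp add: \<omega>_def)
  have 2: "prism_point l (\<omega> + 2 * \<alpha>) s \<in> unit_ball N"
    using in_ball[of "j + 1"] by (simp add: \<omega>_def algebra_simps)
  have 3: "prism_point l (\<omega> + pi) s \<in> unit_ball N"
    using in_ball[of "j + int n"] by (simp add: \<omega>_def algebra_simps flip: na)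
  have conv: "convex (unit_ball N)" unfolding ball by (rule convex_convex_hull)
  \<comment> \<open>The weight of each of the two antipodal points at angles \<open>\<omega>\<close> and \<open>\<omega> + \<pi>\<close> replacing the centre.\<close>
  define w where "w = (1 - u - v) / 2"
  have w0: "0 \<le> w" using uv by (simp add: w_def)
  have "(\<Sum>i<3::nat. [u + w, v, w] ! i *\<^sub>R
      [prism_point l \<omega> s, prism_point l (\<omega> + 2 * \<alpha>) s, prism_point l (\<omega> + pi) s] ! i) \<in> unit_ball N"
  proof (rule convex_sum[OF _ conv])
    show "(\<Sum>i<3::nat. [u + w, v, w] ! i) = 1"
      by (simp add: numeral_3_eq_3 w_def field_simps)
  qed (use 1 2 3 u0 v0 w0 in \<open>auto simp: less_Suc_eq numeral_3_eq_3\<close>)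
  also have "(\<Sum>i<3::nat. [u + w, v, w] ! i *\<^sub>R
      [prism_point l \<omega> s, prism_point l (\<omega> + 2 * \<alpha>) s, prism_point l (\<omega> + pi) s] ! i) = 
      (u + w) *\<^sub>R prism_point l \<omega> s + v *\<^sub>R prism_point l (\<omega> + 2 * \<alpha>) s + w *\<^sub>R prism_point l (\<omega> + pi) s"
    by (simp add: numeral_3_eq_3)
  also have "\<dots> = y"
  proof -
    have sum1: "u + w + v + w = 1" by (simp add: w_def field_simps)
    have "(u + w) * (cos \<omega> + s * l) + v * (cos (\<omega> + 2 * \<alpha>) + s * l) + w * (- cos \<omega> + s * l)
       = (u * cos \<omega> + v * cos (\<omega> + 2 * \<alpha>)) + (u + w + v + w) * (s * l)"
      by (simp add: algebra_simps)
    moreover have "(u + w) * sin \<omega> + v * sin (\<omega> + 2 * \<alpha>) - w * sin \<omega>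
       = u * sin \<omega> + v * sin (\<omega> + 2 * \<alpha>)"
      by (simp add: algebra_simps)
    moreover have "(u + w) * s + v * s + w * s = (u + w + v + w) * s"
      by (simp add: algebra_simps)
    ultimately show ?thesis
      unfolding dec sum1 by (simp add: vec_eq_iff forall_3 y12 s_def mult.commute)
  qed
  finally show ?thesis .
qed

lemma norm_le_from_facets:
  assumes K: "0 < K"
    and lateral: "\<And>k::int. \<bar>lateral_form l ((2 * of_int k + 1) * pi / (2 * real n)) y\<bar> \<le> K * cos (pi / (2 * real n))"
    and height: "\<bar>y$3\<bar> \<le> K"
  shows "N y \<le> K"
proof -
  have "(1 / K) *\<^sub>R y \<in> unit_ball N"
  proof (rule facets_determine_ball)
    show "\<bar>lateral_form l ((2 * of_int k + 1) * pi / (2 * real n)) ((1 / K) *\<^sub>R y)\<bar> \<le> cos (pi / (2 * real n))" for k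
      using lateral[of k] K
      by (simp add: linear_scale[OF linear_lateral_form] abs_mult pos_divide_le_eq mult.commute)
    show "\<bar>((1 / K) *\<^sub>R y) $ 3\<bar> \<le> 1"
      using height K by (simp add: abs_mult field_simps)
  qed
  then show ?thesis
    using K by (simp add: unit_ball_def norm_scale[OF N] field_simps)
qed

section \<open>The lower bound for the numerical radius\<close>

text \<open>
  The two lateral facets through a vertical edge support the ball along the whole edge, not just at
  its endpoints.
\<close>

lemma incident_lateral:
  assumes T: "T \<in> bounded_operators N N" and s: "\<bar>s\<bar> \<le> 1"
    and k: "k = j \<or> k = j - 1"
  shows "\<bar>lateral_form l ((2 * of_int k + 1) * pi / (2 * real n)) (T (prism_point l (of_int j * pi / n) s))\<bar>
     \<le> numerical_radius N T * cos (pi / (2 * real n))"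
proof -
  let ?c = "cos (pi / (2 * real n))" and ?x = "prism_point l (of_int j * pi / n) s"
  let ?g = "lateral_form l ((2 * of_int k + 1) * pi / (2 * real n))"
  have c: "0 < ?c" by (rule cos_half_angle)
  have "\<bar>?g (T ?x) / ?c\<bar> \<le> numerical_radius N T"
  proof (rule numerical_radius_lower[OF N T, where f = "\<lambda>y. ?g y / ?c"])
    show "linear (\<lambda>y. ?g y / ?c)"
      using linear_lateral_form
      by (intro linearI) (simp_all add: linear_add[OF linear_lateral_form]
          linear_scale[OF linear_lateral_form] add_divide_distrib)
    show "\<bar>?g y / ?c\<bar> \<le> 1" if "y \<in> unit_ball N" for y
      using lateral_form_le[OF that, of k] c by (simp add: abs_divide)
    show "?x \<in> unit_ball N" by (rule prism_point_in_ball[OF s])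
    have "(2 * of_int k + 1) * pi / (2 * real n) - of_int j * pi / real n = pi / (2 * real n) \<or>
      (2 * of_int k + 1) * pi / (2 * real n) - of_int j * pi / real n = - (pi / (2 * real n))"
      using k pos_n by (auto simp: field_simps)
    then have "?g ?x = ?c" unfolding lateral_form_prism_point by auto
    then show "?g ?x / ?c = 1" using c by simp
  qed
  then show ?thesis using c by (simp add: abs_divide field_simps)
qed

lemma incident_top:
  assumes T: "T \<in> bounded_operators N N" and s: "s = 1 \<or> s = - 1"
  shows "\<bar>T (prism_point l (of_int j * pi / n) s) $ 3\<bar> \<le> numerical_radius N T"
proof -
  have "\<bar>s * T (prism_point l (of_int j * pi / n) s) $ 3\<bar> \<le> numerical_radius N T"
  proof (rule numerical_radius_lower[OF N T, where f = "\<lambda>y. s * y $ 3"])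
    show "linear (\<lambda>y::real^3. s * y $ 3)"
      by (rule linearI) (simp_all add: algebra_simps)
    show "\<bar>s * y $ 3\<bar> \<le> 1" if "y \<in> unit_ball N" for y
      using height_le[OF that] s by (auto simp: abs_mult)
  qed (use s prism_point_in_ball in auto)
  then show ?thesis using s by (auto simp: abs_mult)
qed

text \<open>
  The reduction to the plane.  Fix the point at angle \<open>\<phi>\<^sub>0\<close> and height \<open>s\<close>, and let \<open>T\<close> act on the point
  at angle \<open>\<phi>\<close> and height \<open>s cos (\<phi> - \<phi>\<^sub>0)\<close>.  This height is linear in the unit vector at angle \<open>\<phi>\<close>, so
  the horizontal part of the image is a linear planar operator; it agrees with \<open>T\<close> at the given point,
  and it inherits the bounds at incident pairs because the height never exceeds 1 in modulus.
\<close>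

lemma lateral_bound:
  assumes T: "T \<in> bounded_operators N N" and s: "\<bar>s\<bar> \<le> 1"
  shows "\<bar>lateral_form l ((2 * of_int k + 1) * pi / (2 * real n)) (T (prism_point l (of_int j * pi / n) s))\<bar>
      * tan (pi / (2 * real n)) \<le> numerical_radius N T * cos (pi / (2 * real n))"
proof -
  have lin: "linear T" using T unfolding bounded_operators_def by auto
  define A where "A = T (vector [1, 0, 0])"
  define B where "B = T (vector [0, 1, 0])"
  define C where "C = T (vector [l, 0, 1])"
  define \<phi>\<^sub>0 where "\<phi>\<^sub>0 = of_int j * pi / n"
  have expand: "T (prism_point l \<phi> t) = cos \<phi> *\<^sub>R A + sin \<phi> *\<^sub>R B + t *\<^sub>R C" for \<phi> t
  proof -
    have "prism_point l \<phi> t = cos \<phi> *\<^sub>R vector [1, 0, 0] + sin \<phi> *\<^sub>R vector [0, 1, 0] + t *\<^sub>R vector [l, 0, 1]"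
      by (simp add: vec_eq_iff forall_3)
    then show ?thesis
      by (simp add: A_def B_def C_def linear_add[OF lin] linear_scale[OF lin])
  qed
  define a where "a = A$1 - l * A$3 + s * cos \<phi>\<^sub>0 * (C$1 - l * C$3)"
  define b where "b = B$1 - l * B$3 + s * sin \<phi>\<^sub>0 * (C$1 - l * C$3)"
  define c where "c = A$2 + s * cos \<phi>\<^sub>0 * C$2"
  define d where "d = B$2 + s * sin \<phi>\<^sub>0 * C$2"
  have form: "plane_form a b c d \<theta> \<phi> = lateral_form l \<theta> (T (prism_point l \<phi> (s * cos (\<phi> - \<phi>\<^sub>0))))" for \<theta> \<phi>
    unfolding expand by (simp add: plane_form_def lateral_form_def a_def b_def c_def d_def cos_diff algebra_simps)
  have t: "\<bar>s * cos \<gamma>\<bar> \<le> 1" for \<gamma>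
    unfolding abs_mult using s abs_cos_le_one[of \<gamma>] by (simp add: mult_le_one)
  have "\<bar>plane_form a b c d ((2 * of_int k + 1) * pi / (2 * real n)) (of_int j * pi / n)\<bar> * tan (pi / (2 * real n))
      \<le> numerical_radius N T * cos (pi / (2 * real n))"
  proof (rule plane_form_bound[OF even_n pos_n])
    fix i :: int
    have "of_int i * pi / n + pi / (2 * real n) = (2 * of_int i + 1) * pi / (2 * real n)"
      "of_int i * pi / n - pi / (2 * real n) = (2 * of_int (i - 1) + 1) * pi / (2 * real n)"
      using pos_n by (simp_all add: field_simps)
    then show "\<bar>plane_form a b c d (of_int i * pi / n + pi / (2 * real n)) (of_int i * pi / n)\<bar>
          \<le> numerical_radius N T * cos (pi / (2 * real n))"
      "\<bar>plane_form a b c d (of_int i * pi / n - pi / (2 * real n)) (of_int i * pi / n)\<bar>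
          \<le> numerical_radius N T * cos (pi / (2 * real n))"
      using incident_lateral[OF T t, of i i] incident_lateral[OF T t, of "i - 1" i]
      unfolding form by simp_all
  qed
  then show ?thesis unfolding form \<phi>\<^sub>0_def[symmetric] by simp
qed

text \<open>
  If the numerical radius were smaller, then \<open>T\<close> would map all vertices into a multiple of the ball
  smaller than the ball itself, against \<open>\<parallel>T\<parallel> = 1\<close>.
\<close>

lemma numerical_radius_ge:
  assumes T: "T \<in> bounded_operators N N" "operator_norm N N T = 1"
  shows "tan (pi / (2 * real n)) \<le> numerical_radius N T"
proof (rule ccontr)
  define \<alpha> where "\<alpha> = pi / (2 * real n)"
  have tan0: "0 < tan \<alpha>" and cos0: "0 < cos \<alpha>"
    using tan_half_angle cos_half_angle by (simp_all add: \<alpha>_def)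
  have tan1: "tan \<alpha> \<le> 1"
  proof -
    have "tan \<alpha> \<le> tan (pi / 4)"
      using half_angle pi_gt_zero unfolding \<alpha>_def by (intro tan_mono_le) linarith+
    then show ?thesis by (simp add: tan_45)
  qed
  assume "\<not> tan (pi / (2 * real n)) \<le> numerical_radius N T"
  then have "numerical_radius N T < tan \<alpha>" by (simp add: \<alpha>_def)
  \<comment> \<open>A bound \<open>w\<close> strictly above the numerical radius is positive even if the latter is zero, so
    that the facet estimates can be rescaled by \<open>K\<close>.\<close>
  then obtain w where w: "numerical_radius N T < w" "w < tan \<alpha>" using dense by blast
  have w0: "0 < w" using incident_top[OF T(1), of 1 0] w(1) by simp
  define K where "K = w / tan \<alpha>"
  have K: "0 < K" "K < 1" using w w0 tan0 by (simp_all add: K_def)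
  have "w * tan \<alpha> \<le> w" using w0 tan1 by simp
  then have wK: "w \<le> K" using tan0 by (simp add: K_def field_simps)
  have lin: "linear T" using T(1) unfolding bounded_operators_def by auto
  have vertex: "N (T v) \<le> K" if v: "v \<in> prism_vertices n l" for v
  proof -
    obtain j s where v: "v = prism_point l (of_int j * pi / n) s" and s: "s = 1 \<or> s = - 1"
      using v unfolding prism_vertices_eq[OF pos_n] by blast
    show ?thesis
    proof (rule norm_le_from_facets[OF K(1)])
      show "\<bar>T v $ 3\<bar> \<le> K"
        using incident_top[OF T(1) s, of j] w wK unfolding v by linarith
      fix k :: int
      have "\<bar>lateral_form l ((2 * of_int k + 1) * pi / (2 * real n)) (T v)\<bar> * tan \<alpha> \<le> numerical_radius N T * cos \<alpha>"
        using lateral_bound[OF T(1), of s k j] s unfolding v \<alpha>_def by auto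
      also have "\<dots> \<le> w * cos \<alpha>" using w cos0 by simp
      finally show "\<bar>lateral_form l ((2 * of_int k + 1) * pi / (2 * real n)) (T v)\<bar> \<le> K * cos (pi / (2 * real n))"
        unfolding K_def \<alpha>_def[symmetric] using tan0 by (simp add: field_simps)
    qed
  qed
  have "N (T x) \<le> K" if "x \<in> unit_ball N" for x
  proof -
    have "N (T x) \<le> K * N x"
      by (rule operator_bound_from_vertices[OF N lin ball vertex])
    also have "\<dots> \<le> K * 1" using that K by (intro mult_left_mono) (auto simp: unit_ball_def)
    finally show ?thesis by simp
  qed
  moreover have "unit_ball N \<noteq> {}" using prism_point_in_ball[of 0 0] by auto
  ultimately have "operator_norm N N T \<le> K"
    unfolding operator_norm_def by (intro cSUP_least) auto
  then show False using T(2) K by simp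
qed

section \<open>The extremal operator\<close>

text \<open>
  In the coordinates of the right prism this is the planar quarter turn followed by the inclusion at
  height zero: the axis, spanned by \<open>(l, 0, 1)\<close>, is its kernel.
\<close>

definition quarter_turn :: "real^3 \<Rightarrow> real^3" where
  "quarter_turn y = vector [- y$2, y$1 - l * y$3, 0]"

lemma linear_quarter_turn: "linear quarter_turn"
  by (rule linearI) (simp_all add: quarter_turn_def vec_eq_iff forall_3 algebra_simps)

lemma quarter_turn_prism_point:
  "quarter_turn (prism_point l \<phi> s) = prism_point l (\<phi> + pi / 2) 0"
  by (simp add: quarter_turn_def vec_eq_iff forall_3 cos_add sin_add)

lemma quarter_turn_contraction: "N (quarter_turn x) \<le> N x"
proof -
  obtain m where m: "n = 2 * m" using even_n by blast
  have "N (quarter_turn v) \<le> 1" if v: "v \<in> prism_vertices n l" for v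
  proof -
    obtain j s where v: "v = prism_point l (of_int j * pi / n) s"
      using v unfolding prism_vertices_eq[OF pos_n] by blast
    have "of_int j * pi / n + pi / 2 = of_int (j + int m) * pi / n"
      using pos_n by (simp add: m field_simps)
    then show ?thesis
      using prism_point_in_ball[of 0 "j + int m"]
      by (simp only: v quarter_turn_prism_point) (simp add: unit_ball_def)
  qed
  then show ?thesis
    using operator_bound_from_vertices[OF N linear_quarter_turn ball, of 1] by simp
qed

text \<open>
  These operators rotate the polygon by one step, \<open>\<pi>/n\<close>, in either direction and shrink heights by the
  factor \<open>cos (\<pi>/n)\<close>, so a vertex goes to a point of a vertical edge.
\<close>

lemma rotation_contraction:
  assumes \<sigma>: "\<sigma> = 1 \<or> \<sigma> = - 1"
  shows "N (cos (pi / n) *\<^sub>R x + (\<sigma> * sin (pi / n)) *\<^sub>R quarter_turn x) \<le> N x"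
proof -
  let ?R = "\<lambda>x. cos (pi / n) *\<^sub>R x + (\<sigma> * sin (pi / n)) *\<^sub>R quarter_turn x"
  have lin: "linear ?R"
    by (intro linear_compose_add linear_compose_scale_right linear_quarter_turn linear_ident)
  have "N (?R v) \<le> 1" if v: "v \<in> prism_vertices n l" for v
  proof -
    obtain j s where v: "v = prism_point l (of_int j * pi / n) s" and s: "s = 1 \<or> s = - 1"
      using v unfolding prism_vertices_eq[OF pos_n] by blast
    obtain i :: int where i: "\<sigma> = of_int i" using \<sigma> by (metis of_int_1 of_int_minus)
    have "?R v = prism_point l (of_int j * pi / n + \<sigma> * (pi / n)) (s * cos (pi / n))"
      unfolding v quarter_turn_prism_point using \<sigma>
      by (auto simp: vec_eq_iff forall_3 cos_add sin_add cos_diff sin_diff algebra_simps)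
    also have "of_int j * pi / n + \<sigma> * (pi / n) = of_int (j + i) * pi / n"
      by (simp add: i algebra_simps add_divide_distrib)
    also have "prism_point l \<dots> (s * cos (pi / n)) \<in> unit_ball N"
      using s by (intro prism_point_in_ball) (auto simp: abs_mult)
    finally show ?thesis by (simp add: unit_ball_def)
  qed
  then show ?thesis
    using operator_bound_from_vertices[OF N lin ball, of 1] by simp
qed

lemma quarter_turn_bounded: "quarter_turn \<in> bounded_operators N N"
  unfolding bounded_operators_def using linear_quarter_turn quarter_turn_contraction
  by (auto intro!: exI[of _ 1])

text \<open>
  The fourth power of a contraction cannot fix a nonzero vector unless the norm of that vector is
  preserved at each step; \<open>prism_point l 0 0\<close> is such a fixed vector.
\<close>

lemma operator_norm_quarter_turn: "operator_norm N N quarter_turn = 1"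
proof -
  define e where "e = prism_point l 0 0"
  have "quarter_turn (quarter_turn (quarter_turn (quarter_turn e))) = e"
    by (simp add: e_def quarter_turn_def vec_eq_iff forall_3)
  then have "N e \<le> N (quarter_turn e)"
    by (metis quarter_turn_contraction order_trans)
  then have eq: "N (quarter_turn e) = N e"
    using quarter_turn_contraction[of e] by simp
  have "e $ 1 \<noteq> 0" by (simp add: e_def)
  then have "N e > 0"
    using norm_ge_0[OF N, of e] norm_eq_0[OF N, of e] by (auto simp: less_le)
  then have unit: "N ((1 / N e) *\<^sub>R e) = 1" "N (quarter_turn ((1 / N e) *\<^sub>R e)) = 1"
    by (simp_all add: linear_scale[OF linear_quarter_turn] norm_scale[OF N] eq)
  have "Sup ((\<lambda>x. N (quarter_turn x)) ` unit_ball N) = 1"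
  proof (rule cSup_eq_maximum)
    show "1 \<in> (\<lambda>x. N (quarter_turn x)) ` unit_ball N"
      using unit by (intro image_eqI[of _ _ "(1 / N e) *\<^sub>R e"]) (auto simp: unit_ball_def)
    show "r \<le> 1" if "r \<in> (\<lambda>x. N (quarter_turn x)) ` unit_ball N" for r
      using that quarter_turn_contraction by (auto simp: unit_ball_def intro: order_trans)
  qed
  then show ?thesis unfolding operator_norm_def .
qed

lemma numerical_radius_quarter_turn: "numerical_radius N quarter_turn \<le> tan (pi / (2 * real n))"
proof -
  have top: "linear (\<lambda>y::real^3. y $ 3)" by (rule linearI) simp_all
  have "prism_point l 0 1 \<in> unit_ball N" using prism_point_in_ball[of 1 0] by simp
  note pair = supporting_functional[OF N top height_le this]
  have double: "pi / real n = 2 * (pi / (2 * real n))" by simp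
  have s: "0 < sin (pi / real n)"
    unfolding double sin_double using sin_half_angle cos_half_angle by simp
  have "numerical_radius N quarter_turn \<le> (1 - cos (pi / n)) / sin (pi / n)"
    using rotation_contraction[of 1] rotation_contraction[of "- 1"]
    by (intro numerical_radius_upper_of_contractions[OF N s _ _ pair]) auto
  also have "\<dots> = tan (pi / (2 * real n))"
    unfolding double sin_double cos_double_sin tan_def
    using sin_half_angle cos_half_angle by (simp add: power2_eq_square)
  finally show ?thesis .
qed

end

theorem theorem2p5:
  fixes N :: "real^3 \<Rightarrow> real" and l :: real and n :: nat
  assumes "even n" and "n > 0"
    and "is_norm N" and "polyhedral N"
    and "unit_ball N = convex hull (prism_vertices n l)"
  shows "numerical_index N = tan (pi / (2 * real n))"
proof -
  interpret prism_norm N l n using assms by unfold_locales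
  have attained: "numerical_radius N quarter_turn = tan (pi / (2 * real n))"
    using numerical_radius_quarter_turn
      numerical_radius_ge[OF quarter_turn_bounded operator_norm_quarter_turn] by simp
  show ?thesis
    unfolding numerical_index_def
  proof (rule cInf_eq_minimum)
    show "tan (pi / (2 * real n)) \<in>
        {numerical_radius N T | T. T \<in> bounded_operators N N \<and> operator_norm N N T = 1}"
      unfolding attained[symmetric] using quarter_turn_bounded operator_norm_quarter_turn by blast
  qed (use numerical_radius_ge in auto)
qed

end
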